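(* Let $d\ge 1$. For every instance $\mathcal{R}$ of the MinUsageTime Dynamic Vector Bin Packing problem in $d$ dimensions, the Next Fit algorithm satisfies \[\mathsf{cost}(\mathrm{NF},\mathcal{R}) \le (2\mu d+1)\cdot \mathsf{OPT}(\mathcal{R}),\] where $\mu$ is the ratio of the maximum to the minimum item duration in $\mathcal{R}$. That is, the competitive ratio of Next Fit is at most $2\mu d+1$.
   Context: MinUsageTime Dynamic Vector Bin Packing (non-clairvoyant, online, no repacking): an instance is a finite list $\mathcal{R}$ of items; each item $r$ has arrival time $a(r)\ge 0$, departure time $e(r)>a(r)$, and size $\mathbf{s}(r)\in[0,1]^d$. Its active interval is $I(r)=[a(r),e(r))$ with duration $\ell(I(r))=e(r)-a(r)$; $\mu=\max_r \ell(I(r))/\min_r \ell(I(r))$. Bins have capacity $1$ in each of the $d$ coordinates. Items are revealed in order of arrival (ties in a given order); on arrival, an item must be irrevocably placed into a bin such that the total size of items currently active in that bin stays $\le 1$ in every coordinate; the departure time is unknown at arrival. A bin is open while it contains an active item; once all its items have departed it is closed and never used again. If bin $B_i$ receives item set $R_i$, the cost of algorithm $\mathcal{A}$ is $\mathsf{cost}(\mathcal{A},\mathcal{R})=\sum_i \mathrm{span}(R_i)$, where $\mathrm{span}(S)$ is the Lebesgue measure of $\bigcup_{r\in S} I(r)$. $\mathsf{OPT}(\mathcal{R})=\int \mathsf{OPT}(\mathcal{R},t)\,dt$, where $\mathsf{OPT}(\mathcal{R},t)$ is the minimum number of unit-capacity bins into which the items active at time $t$ can be packed (offline, repacking allowed).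 Next Fit: at any time there is at most one designated current bin; an arriving item is placed in the current bin if it fits; otherwise the current bin is released (it receives no further items) and a new bin is opened for the item and becomes the current bin (a new bin is also opened if there is no open current bin). *)

theory Defs
  imports "HOL-Analysis.Analysis" "HOL-Library.Multiset"
begin

text \<open>The dimension d is the cardinality of the index type \<open>'d\<close>. Bins are lists of items and
  may contain equal items several times, as instances may.\<close>

record ('d::finite) item =
  arrival :: real
  departure :: real
  item_size :: "real ^ 'd"

definition interval :: "'d::finite item \<Rightarrow> real set" where
  "interval r = {arrival r ..< departure r}"

definition duration :: "'d::finite item \<Rightarrow> real" where
  "duration r = departure r - arrival r"

text \<open>Instances are listed in the order in which the items are revealed; the list order
  breaks ties between equal arrival times.\<close>

definition dvbp_instance :: "'d::finite item list \<Rightarrow> bool" where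
  "dvbp_instance R \<longleftrightarrow>
     sorted (map arrival R) \<and>
     (\<forall>r \<in> set R. 0 \<le> arrival r \<and> arrival r < departure r \<and>
        (\<forall>k. 0 \<le> item_size r $ k \<and> item_size r $ k \<le> 1))"

text \<open>Meaningful for nonempty instances only.\<close>

definition duration_ratio :: "'d::finite item list \<Rightarrow> real" where
  "duration_ratio R = Max (duration ` set R) / Min (duration ` set R)"

definition active_items :: "real \<Rightarrow> 'd::finite item list \<Rightarrow> 'd item list" where
  "active_items t B = filter (\<lambda>r. t \<in> interval r) B"

definition within_capacity :: "'d::finite item list \<Rightarrow> bool" where
  "within_capacity B \<longleftrightarrow> (\<forall>k. (\<Sum>r\<leftarrow>B. item_size r $ k) \<le> 1)"

definition span_length :: "'d::finite item list \<Rightarrow> real" where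
  "span_length B = measure lborel (\<Union>r \<in> set B. interval r)"

definition packing_cost :: "'d::finite item list list \<Rightarrow> real" where
  "packing_cost P = (\<Sum>B\<leftarrow>P. span_length B)"

text \<open>The state of Next Fit is the list of all bins opened so far, most recent first, each with
  all items it ever received. Only the head can be the current bin: it is the current bin as
  long as it is open, i.e. contains an active item. Neither a released bin nor a closed one
  receives further items.\<close>

fun next_fit_step :: "'d::finite item list list \<Rightarrow> 'd item \<Rightarrow> 'd item list list" where
  "next_fit_step [] r = [[r]]"
| "next_fit_step (B # Bs) r =
     (let A = active_items (arrival r) B in
      if A \<noteq> [] \<and> within_capacity (A @ [r])
      then (B @ [r]) # Bs
      else [r] # B # Bs)"

definition next_fit :: "'d::finite item list \<Rightarrow> 'd item list list" where
  "next_fit R = foldl next_fit_step [] R"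

text \<open>On instances the minimum exists, since every single item fits into a bin of its own.\<close>

definition opt_at :: "'d::finite item list \<Rightarrow> real \<Rightarrow> nat" where
  "opt_at R t = (LEAST n. \<exists>P. length P = n \<and>
     mset (concat P) = mset (active_items t R) \<and> (\<forall>B \<in> set P. within_capacity B))"

text \<open>On instances the integrand is a step function with bounded support, so the integral is
  not subject to the default value 0 for non-integrable functions.\<close>

definition opt :: "'d::finite item list \<Rightarrow> real" where
  "opt R = (LINT t|lborel. real (opt_at R t))"

end

theory Submission
  imports Defs
begin

text \<open>The usage time of a bin splits into the time up to the opening of its successor and the
  remaining time. The former parts are disjoint subsets of the time covered by the instance, on
  which every packing needs at least one bin. A latter part is nonempty only if the bin is
  released while still open; its length is then at most the maximal duration, and the items
  active in the bin together with the first item of its successor exceed the capacity in some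
  coordinate. As every item is charged at most twice in this way, the number of such releases is
  bounded by twice the total size times duration of all items over the minimal duration, and
  this total is at most \<open>d\<close> times the optimum.\<close>

section \<open>Covered time and space-time volume of items\<close>

definition covered :: "'d::finite item list \<Rightarrow> real set" where
  "covered B = (\<Union>r \<in> set B. interval r)"

definition total_size :: "'d::finite item \<Rightarrow> real" where
  "total_size r = (\<Sum>k\<in>UNIV. item_size r $ k)"

text \<open>The space-time volume of the items, with sizes summed over all coordinates;
  \<open>has_integral_demand\<close> identifies it as the integral of the total active size.\<close>

definition demand :: "'d::finite item list \<Rightarrow> real" where
  "demand B = (\<Sum>r\<leftarrow>B. total_size r * duration r)"

lemma covered_mono: "set A \<subseteq> set B \<Longrightarrow> covered A \<subseteq> covered B"
  by (auto simp: covered_def)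

lemma demand_simps [simp]:
  "demand [] = 0"
  "demand (r # B) = total_size r * duration r + demand B"
  "demand (A @ B) = demand A + demand B"
  by (simp_all add: demand_def)

lemma fmeasurable_interval [simp, intro]: "interval r \<in> fmeasurable lborel"
proof (rule fmeasurableI)
  show "emeasure lborel (interval r) < \<infinity>"
    unfolding interval_def by (rule emeasure_bounded_finite) simp
qed (simp add: interval_def)

lemma fmeasurable_covered [simp, intro]: "covered B \<in> fmeasurable lborel"
  unfolding covered_def
  by (intro fmeasurable.finite_UN) auto

lemma sets_covered [simp, measurable]: "covered B \<in> sets borel"
  using fmeasurable_covered[of B] fmeasurableD by fastforce

lemma fmeasurable_covered_Int [simp, intro]:
  "S \<in> sets borel \<Longrightarrow> covered B \<inter> S \<in> fmeasurable lborel"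
  by (rule fmeasurable_Int_fmeasurable) auto

lemma dvbp_instance_snoc:
  "dvbp_instance (R @ [r]) \<longleftrightarrow> dvbp_instance R \<and> dvbp_instance [r] \<and> (\<forall>x\<in>set R. arrival x \<le> arrival r)"
  by (auto simp: dvbp_instance_def sorted_append)

lemma item_size_nonneg: "dvbp_instance R \<Longrightarrow> r \<in> set R \<Longrightarrow> 0 \<le> item_size r $ k"
  by (simp add: dvbp_instance_def)

lemma duration_pos: "dvbp_instance R \<Longrightarrow> r \<in> set R \<Longrightarrow> 0 < duration r"
  by (simp add: dvbp_instance_def duration_def)

lemma total_size_nonneg: "dvbp_instance R \<Longrightarrow> r \<in> set R \<Longrightarrow> 0 \<le> total_size r"
  by (simp add: total_size_def sum_nonneg item_size_nonneg)

lemma item_size_le_total_size: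
  "dvbp_instance R \<Longrightarrow> r \<in> set R \<Longrightarrow> item_size r $ k \<le> total_size r"
  unfolding total_size_def by (rule member_le_sum) (auto simp: item_size_nonneg)

lemma sum_list_filter_le:
  fixes f :: "'a \<Rightarrow> real"
  assumes "\<And>x. x \<in> set xs \<Longrightarrow> 0 \<le> f x"
  shows "(\<Sum>x\<leftarrow>filter Q xs. f x) \<le> (\<Sum>x\<leftarrow>xs. f x)"
  using assms by (induction xs) (auto simp: add_increasing)

lemma demand_nonneg:
  assumes "dvbp_instance R" "set B \<subseteq> set R"
  shows "0 \<le> demand B"
  unfolding demand_def using assms
  by (intro sum_list_nonneg)
     (auto intro!: mult_nonneg_nonneg total_size_nonneg less_imp_le[OF duration_pos])

lemma demand_active_items_le:
  assumes "dvbp_instance R" "set B \<subseteq> set R"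
  shows "demand (active_items t B) \<le> demand B"
  unfolding demand_def active_items_def
  using assms
  by (intro sum_list_filter_le mult_nonneg_nonneg)
     (auto intro: total_size_nonneg less_imp_le duration_pos)

text \<open>A single overfull coordinate is enough: there every item contributes at most its
  \<open>total_size\<close>, and it lasts for a time of at least \<open>m\<close>.\<close>

lemma demand_ge_if_exceeds_capacity:
  assumes "dvbp_instance R" "set B \<subseteq> set R" "\<And>r. r \<in> set R \<Longrightarrow> m \<le> duration r" "0 \<le> m"
    and "\<not> within_capacity B"
  shows "m \<le> demand B"
proof -
  obtain k where k: "1 < (\<Sum>r\<leftarrow>B. item_size r $ k)"
    using assms(5) by (auto simp: within_capacity_def not_le)
  have "m \<le> m * (\<Sum>r\<leftarrow>B. item_size r $ k)"
    using k \<open>0 \<le> m\<close> by (simp add: mult_le_cancel_left1)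
  also have "\<dots> = (\<Sum>r\<leftarrow>B. m * item_size r $ k)"
    by (simp add: sum_list_const_mult)
  also have "\<dots> \<le> demand B"
    unfolding demand_def
  proof (rule sum_list_mono)
    fix r assume "r \<in> set B"
    with assms show "m * item_size r $ k \<le> total_size r * duration r"
      by (subst mult.commute, intro mult_mono)
         (auto intro: item_size_le_total_size total_size_nonneg)
  qed
  finally show ?thesis .
qed

section \<open>Splitting usage times at the opening of the next bin\<close>

text \<open>An item that arrived by \<open>t\<close> and is active at some later time is active at
  \<open>t\<close> as well, so a bin without active items at \<open>t\<close> has no usage time
  left. In any case its items depart by \<open>t + M\<close>.\<close>

lemma covered_beyond_subset:
  assumes "\<And>r. r \<in> set B \<Longrightarrow> arrival r \<le> t" "\<And>r. r \<in> set B \<Longrightarrow> duration r \<le> M"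
  shows "covered B \<inter> {t..} \<subseteq> (if active_items t B = [] then {} else {t..t + M})"
proof (cases "active_items t B = []")
  case True
  have "x < t" if "r \<in> set B" "x \<in> interval r" for r x
    using that assms(1)[of r] True
    by (force simp: active_items_def filter_empty_conv interval_def)
  with True show ?thesis
    by (force simp: covered_def)
next
  case False
  then show ?thesis
    using assms by (fastforce simp: covered_def interval_def duration_def)
qed

lemma measure_covered_beyond_le:
  assumes "\<And>r. r \<in> set B \<Longrightarrow> arrival r \<le> t" "\<And>r. r \<in> set B \<Longrightarrow> duration r \<le> M" "0 \<le> M"
  shows "measure lborel (covered B \<inter> {t..}) \<le> (if active_items t B = [] then 0 else M)"
proof -
  have "measure lborel (covered B \<inter> {t..}) \<le>
      measure lborel (if active_items t B = [] then {} else {t..t + M})"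
    using covered_beyond_subset[of B t M] assms fmeasurable_cbox[of t "t + M"]
    by (intro measure_mono_fmeasurable) (auto simp: fmeasurableD split: if_splits)
  also have "\<dots> = (if active_items t B = [] then 0 else M)"
    using \<open>0 \<le> M\<close> by simp
  finally show ?thesis .
qed

text \<open>The usage time of \<open>B\<close> starts no earlier than \<open>a\<close>, hence is
  disjoint from everything before \<open>a\<close>. The set \<open>S\<close> will be the time before
  the next bin opens, or \<open>UNIV\<close> for the last bin.\<close>

lemma measure_covered_before_add_le:
  assumes "set B \<subseteq> set R" "\<And>r. r \<in> set B \<Longrightarrow> a \<le> arrival r" "{..<a} \<subseteq> S" "S \<in> sets borel"
  shows "measure lborel (covered R \<inter> {..<a}) + measure lborel (covered B \<inter> S)
    \<le> measure lborel (covered R \<inter> S)"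
proof -
  have "x \<ge> a" if "x \<in> covered B" for x
    using that assms(2) by (force simp: covered_def interval_def)
  then have "measure lborel (covered R \<inter> {..<a}) + measure lborel (covered B \<inter> S) =
      measure lborel (covered R \<inter> {..<a} \<union> covered B \<inter> S)"
    using assms(4) by (intro measure_Un_AE[symmetric] AE_I2) force+
  also have "\<dots> \<le> measure lborel (covered R \<inter> S)"
    using covered_mono[OF assms(1)] assms(3,4)
    by (intro measure_mono_fmeasurable) auto
  finally show ?thesis .
qed

section \<open>Cost of Next Fit\<close>

lemma next_fit_snoc: "next_fit (R @ [r]) = next_fit_step (next_fit R) r"
  by (simp add: next_fit_def)

text \<open>Here \<open>a\<close> is the opening time of the most recent bin \<open>B\<close>, and \<open>n\<close> is the number of bins
  released while still open.\<close>

lemma next_fit_invariant: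
  assumes "dvbp_instance R" "R \<noteq> []"
    and "\<And>r. r \<in> set R \<Longrightarrow> m \<le> duration r" "\<And>r. r \<in> set R \<Longrightarrow> duration r \<le> M"
    and "0 \<le> m" "0 \<le> M"
  shows "\<exists>B Bs a n. next_fit R = B # Bs \<and> B \<noteq> [] \<and> set B \<subseteq> set R \<and>
    (\<forall>r\<in>set B. a \<le> arrival r) \<and>
    packing_cost Bs \<le> M * real n + measure lborel (covered R \<inter> {..<a}) \<and>
    m * real n + demand B \<le> 2 * demand R"
  using assms
proof (induction R rule: rev_induct)
  case Nil
  then show ?case by simp
next
  case (snoc r R)
  have inst: "dvbp_instance R" and le: "\<And>x. x \<in> set R \<Longrightarrow> arrival x \<le> arrival r"
    using snoc.prems(1) by (auto simp: dvbp_instance_snoc)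
  have vol_r: "0 \<le> total_size r * duration r"
    using total_size_nonneg[OF snoc.prems(1), of r] duration_pos[OF snoc.prems(1), of r] by simp
  show ?case
  proof (cases "R = []")
    case True
    have "next_fit (R @ [r]) = [r] # []"
      using True by (simp add: next_fit_def)
    with True vol_r show ?thesis
      by (intro exI[of _ "[r]"] exI[of _ "[]"] exI[of _ "arrival r"] exI[of _ 0])
         (auto simp: packing_cost_def mult.commute)
  next
    case False
    have "\<And>x. x \<in> set R \<Longrightarrow> m \<le> duration x" "\<And>x. x \<in> set R \<Longrightarrow> duration x \<le> M"
      using snoc.prems(3,4) by auto
    from snoc.IH[OF inst False this snoc.prems(5,6)]
    obtain B Bs a n where nf: "next_fit R = B # Bs" and B: "B \<noteq> []" "set B \<subseteq> set R"
      and a: "\<And>x. x \<in> set B \<Longrightarrow> a \<le> arrival x"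
      and cost: "packing_cost Bs \<le> M * real n + measure lborel (covered R \<inter> {..<a})"
      and vol: "m * real n + demand B \<le> 2 * demand R"
      by blast
    let ?t = "arrival r" and ?R = "R @ [r]"
    let ?A = "active_items ?t B"
    have leB: "arrival x \<le> ?t" if "x \<in> set B" for x
      using that B le by auto
    have "a \<le> ?t"
      using B a leB by (meson hd_in_set order_trans)
    show ?thesis
    proof (cases "?A \<noteq> [] \<and> within_capacity (?A @ [r])")
      case True
      then have "next_fit ?R = (B @ [r]) # Bs"
        by (simp add: next_fit_snoc nf)
      moreover have "measure lborel (covered R \<inter> {..<a}) \<le> measure lborel (covered ?R \<inter> {..<a})"
        using covered_mono[of R ?R] by (intro measure_mono_fmeasurable) (auto simp: fmeasurableD)
      \<comment> \<open>The volume of \<open>r\<close> enters \<open>demand B\<close> once and the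
        right-hand side twice, while \<open>a\<close> and \<open>n\<close> stay the same.\<close>
      ultimately show ?thesis
        using B a \<open>a \<le> ?t\<close> cost vol vol_r
        by (intro exI[of _ "B @ [r]"] exI[of _ Bs] exI[of _ a] exI[of _ n]) (auto simp: mult.commute)
    next
      case new: False
      then have nf': "next_fit ?R = [r] # B # Bs"
        by (auto simp: next_fit_snoc nf Let_def)
      \<comment> \<open>A bin that has already closed leaves no usage time beyond \<open>?t\<close>,
        so only the release of a bin with active items is counted.\<close>
      define n' where "n' = (if ?A = [] then n else Suc n)"
      have "span_length B =
          measure lborel (covered B \<inter> {..<?t} \<union> covered B \<inter> {?t..})"
        unfolding span_length_def covered_def[symmetric]
        by (rule arg_cong[of _ _ "measure lborel"]) auto
      also have "\<dots> \<le> measure lborel (covered B \<inter> {..<?t}) + measure lborel (covered B \<inter> {?t..})"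
        by (rule measure_Un_le) (auto simp: fmeasurableD)
      also have "measure lborel (covered B \<inter> {?t..}) \<le> (if ?A = [] then 0 else M)"
        using leB B snoc.prems by (intro measure_covered_beyond_le) auto
      finally have span: "span_length B \<le>
          measure lborel (covered B \<inter> {..<?t}) + (if ?A = [] then 0 else M)"
        by simp
      \<comment> \<open>The covered time charged to older bins lies before \<open>a\<close>, that
        charged to \<open>B\<close> between \<open>a\<close> and \<open>?t\<close>; together they
        fit into the covered time before \<open>?t\<close>.\<close>
      have "measure lborel (covered R \<inter> {..<a}) + measure lborel (covered B \<inter> {..<?t})
          \<le> measure lborel (covered R \<inter> {..<?t})"
        using B a \<open>a \<le> ?t\<close> by (intro measure_covered_before_add_le) auto
      also have "\<dots> \<le> measure lborel (covered ?R \<inter> {..<?t})"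
        using covered_mono[of R ?R] by (intro measure_mono_fmeasurable) (auto simp: fmeasurableD)
      finally have "packing_cost (B # Bs) \<le> M * real n' + measure lborel (covered ?R \<inter> {..<?t})"
        using span cost by (auto simp: packing_cost_def n'_def algebra_simps)
      moreover have "m * real n' + demand [r] \<le> 2 * demand ?R"
      proof (cases "?A = []")
        case True
        have "0 \<le> demand B"
          by (rule demand_nonneg[OF inst B(2)])
        with True vol vol_r show ?thesis
          by (simp add: n'_def mult.commute)
      next
        case False
        with new have "\<not> within_capacity (?A @ [r])" by simp
        \<comment> \<open>The overflow pays for the release: the reserve \<open>demand B\<close>
          kept by the invariant is spent, and the volume of \<open>r\<close> is used once here and
          once as the reserve of the new bin, whence the factor 2.\<close>
        then have "m \<le> demand (?A @ [r])"
          using snoc.prems B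
          by (intro demand_ge_if_exceeds_capacity[of ?R]) (auto simp: active_items_def)
        also have "\<dots> \<le> demand B + demand [r]"
          using demand_active_items_le[OF inst B(2), of ?t] by simp
        finally show ?thesis
          using False vol by (simp add: n'_def algebra_simps)
      qed
      ultimately show ?thesis
        using nf' by (intro exI[of _ "[r]"] exI[of _ "B # Bs"] exI[of _ ?t] exI[of _ n']) auto
    qed
  qed
qed

lemma next_fit_cost_le:
  assumes "dvbp_instance R"
    and "\<And>r. r \<in> set R \<Longrightarrow> m \<le> duration r" "\<And>r. r \<in> set R \<Longrightarrow> duration r \<le> M"
    and "0 < m" "0 \<le> M"
  shows "packing_cost (next_fit R) \<le> 2 * (M / m) * demand R + measure lborel (covered R)"
proof (cases "R = []")
  case True
  then show ?thesis by (simp add: next_fit_def packing_cost_def)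
next
  case False
  from next_fit_invariant[OF assms(1) False assms(2,3) less_imp_le[OF \<open>0 < m\<close>] \<open>0 \<le> M\<close>]
  obtain B Bs a n where nf: "next_fit R = B # Bs" and B: "set B \<subseteq> set R"
    and a: "\<And>x. x \<in> set B \<Longrightarrow> a \<le> arrival x"
    and cost: "packing_cost Bs \<le> M * real n + measure lborel (covered R \<inter> {..<a})"
    and vol: "m * real n + demand B \<le> 2 * demand R"
    by blast
  have "0 \<le> demand B"
    by (rule demand_nonneg[OF assms(1) B])
  \<comment> \<open>The unspent reserve \<open>demand B\<close> of the last bin is dropped.\<close>
  with vol have "real n \<le> 2 * demand R / m"
    using \<open>0 < m\<close> by (simp add: field_simps)
  from mult_left_mono[OF this \<open>0 \<le> M\<close>] have "M * real n \<le> 2 * (M / m) * demand R"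
    by (simp add: mult.commute mult.left_commute)
  \<comment> \<open>The last bin has no successor, so its entire usage time joins the disjoint
    parts.\<close>
  moreover have "measure lborel (covered R \<inter> {..<a}) + measure lborel (covered B)
      \<le> measure lborel (covered R)"
    using measure_covered_before_add_le[OF B a, of UNIV] by simp
  ultimately show ?thesis
    using nf cost by (simp add: packing_cost_def span_length_def covered_def)
qed

section \<open>The offline optimum at a fixed time\<close>

text \<open>One bin per active item is a valid packing since no size exceeds 1; hence the minimum in
  \<open>opt_at\<close> is attained.\<close>

lemma
  assumes "dvbp_instance R"
  shows opt_at_witness: "\<exists>P. length P = opt_at R t \<and> mset (concat P) = mset (active_items t R) \<and>
    (\<forall>B\<in>set P. within_capacity B)"
    and opt_at_le_length: "opt_at R t \<le> length R"
proof -
  let ?P = "map (\<lambda>r. [r]) (active_items t R)"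
  let ?Q = "\<lambda>n. \<exists>P. length P = n \<and> mset (concat P) = mset (active_items t R) \<and>
    (\<forall>B\<in>set P. within_capacity B)"
  have Q: "?Q (length (active_items t R))"
    using assms
    by (intro exI[of _ ?P]) (auto simp: within_capacity_def active_items_def dvbp_instance_def)
  show "?Q (opt_at R t)"
    unfolding opt_at_def by (rule LeastI[of ?Q, OF Q])
  have "opt_at R t \<le> length (active_items t R)"
    unfolding opt_at_def by (rule Least_le[of ?Q, OF Q])
  also have "\<dots> \<le> length R"
    by (simp add: active_items_def)
  finally show "opt_at R t \<le> length R" .
qed

lemma active_items_eq_Nil_iff: "active_items t R = [] \<longleftrightarrow> t \<notin> covered R"
  by (auto simp: active_items_def covered_def filter_empty_conv)

text \<open>Zero bins hold only the empty list. This gives both the lower bound of one bin at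
  covered times and the bounded support of the optimum.\<close>

lemma opt_at_eq_0_iff:
  assumes "dvbp_instance R"
  shows "opt_at R t = 0 \<longleftrightarrow> t \<notin> covered R"
proof
  assume "opt_at R t = 0"
  then show "t \<notin> covered R"
    using opt_at_witness[OF assms, of t] by (auto simp flip: active_items_eq_Nil_iff)
next
  assume "t \<notin> covered R"
  then have "active_items t R = []"
    by (simp add: active_items_eq_Nil_iff)
  then show "opt_at R t = 0"
    unfolding opt_at_def by (intro Least_eq_0 exI[of _ "[]"]) simp
qed

text \<open>A bin holds at most 1 per coordinate, hence total size at most \<open>CARD('d)\<close>;
  this is summed over the bins of an optimal packing.\<close>

lemma total_size_active_le_opt_at:
  fixes R :: "'d::finite item list"
  assumes "dvbp_instance R"
  shows "(\<Sum>r\<leftarrow>active_items t R. total_size r) \<le> real CARD('d) * real (opt_at R t)"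
proof -
  obtain P where P: "length P = opt_at R t" "mset (concat P) = mset (active_items t R)"
    "\<And>B. B \<in> set P \<Longrightarrow> within_capacity B"
    using opt_at_witness[OF assms] by blast
  have bin: "(\<Sum>r\<leftarrow>B. total_size r) \<le> real CARD('d)" if "within_capacity B" for B :: "'d item list"
  proof -
    have "(\<Sum>r\<leftarrow>B. total_size r) = (\<Sum>k\<in>UNIV. \<Sum>r\<leftarrow>B. item_size r $ k)"
      unfolding total_size_def by (induction B) (auto simp: sum.distrib)
    also have "\<dots> \<le> (\<Sum>k\<in>(UNIV::'d set). 1)"
      using that by (intro sum_mono) (simp add: within_capacity_def)
    finally show ?thesis by simp
  qed
  \<comment> \<open>The packing determines the active items only up to order, so the sums are
    compared as sums over multisets.\<close>
  have "(\<Sum>r\<leftarrow>active_items t R. total_size r) = (\<Sum>r\<leftarrow>concat P. total_size r)"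
    using P(2) by (metis mset_map sum_mset_sum_list)
  also have "\<dots> \<le> real CARD('d) * real (length P)"
    using P(3)
  proof (induction P)
    case (Cons B P)
    then show ?case using bin[of B] by (auto simp: algebra_simps)
  qed simp
  finally show ?thesis using P(1) by simp
qed

text \<open>The discrete \<open>\<sigma>\<close>-algebra on lists makes the dependence of the optimum on the active items
  trivially measurable.\<close>

lemma measurable_active_items:
  "(\<lambda>t. active_items t R) \<in> borel \<rightarrow>\<^sub>M count_space UNIV"
proof (induction R)
  case Nil
  then show ?case by (simp add: active_items_def)
next
  case (Cons r R)
  have "(\<lambda>t. r # active_items t R) \<in> borel \<rightarrow>\<^sub>M count_space UNIV"
    by (rule measurable_compose[OF Cons]) simp
  with Cons have "(\<lambda>t. if t \<in> interval r then r # active_items t R else active_items t R)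
      \<in> borel \<rightarrow>\<^sub>M count_space UNIV"
    by (intro measurable_If) (auto simp: interval_def)
  then show ?case
    by (simp add: active_items_def if_distrib cong: if_cong)
qed

text \<open>The optimum is bounded by the number of items and vanishes off \<open>covered R\<close>,
  which has finite measure. Integrability is what monotonicity of the integral requires
  below.\<close>

lemma integrable_opt_at:
  assumes "dvbp_instance R"
  shows "integrable lborel (\<lambda>t. real (opt_at R t))"
proof (rule Bochner_Integration.integrable_bound)
  show "integrable lborel (\<lambda>t. real (length R) * indicator (covered R) t)"
    using fmeasurable_covered[of R] by (auto simp: fmeasurable_def)
  have "(\<lambda>t. real (opt_at R t)) \<in> borel \<rightarrow>\<^sub>M borel"
    unfolding opt_at_def by (rule measurable_compose[OF measurable_active_items]) simp
  then show "(\<lambda>t. real (opt_at R t)) \<in> borel_measurable lborel"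
    by simp
  show "AE t in lborel. norm (real (opt_at R t)) \<le> norm (real (length R) * indicator (covered R) t)"
    using opt_at_le_length[OF assms] opt_at_eq_0_iff[OF assms]
    by (intro AE_I2) (auto simp: indicator_def)
qed

section \<open>Lower bounds on the optimum by integration over time\<close>

lemma measure_covered_le_opt:
  assumes "dvbp_instance R"
  shows "measure lborel (covered R) \<le> opt R"
proof -
  have "measure lborel (covered R) = (LINT t|lborel. indicator (covered R) t)"
    by simp
  also have "\<dots> \<le> opt R"
    unfolding opt_def
  proof (rule integral_mono[OF _ integrable_opt_at[OF assms]])
    show "integrable lborel (indicator (covered R) :: real \<Rightarrow> real)"
      using fmeasurable_covered[of R] by (auto simp: fmeasurable_def)
    show "indicator (covered R) t \<le> real (opt_at R t)" for t
      using opt_at_eq_0_iff[OF assms, of t] by (auto simp: indicator_def)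
  qed
  finally show ?thesis .
qed

text \<open>Summation over items is exchanged with integration over time: each item contributes its
  \<open>total_size\<close> throughout its interval.\<close>

lemma has_integral_demand:
  assumes "\<And>r. r \<in> set R \<Longrightarrow> 0 \<le> duration r"
  shows "has_bochner_integral lborel (\<lambda>t. \<Sum>r\<leftarrow>active_items t R. total_size r) (demand R)"
  using assms
proof (induction R)
  case Nil
  then show ?case by (simp add: active_items_def has_bochner_integral_zero)
next
  case (Cons r R)
  have "has_bochner_integral lborel (indicator (interval r)) (measure lborel (interval r))"
    by (rule has_bochner_integral_real_indicator) (use fmeasurable_interval[of r] in \<open>auto simp: fmeasurable_def\<close>)
  then have "has_bochner_integral lborel (\<lambda>t. total_size r * indicator (interval r) t)
      (total_size r * duration r)"
    \<comment> \<open>Nonnegativity makes the measure of the interval equal to the duration instead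
      of 0.\<close>
    using Cons.prems[of r]
    by (intro has_bochner_integral_mult_right) (simp add: interval_def duration_def)
  from has_bochner_integral_add[OF this Cons.IH] Cons.prems
  have "has_bochner_integral lborel (\<lambda>t. total_size r * indicator (interval r) t +
      (\<Sum>r\<leftarrow>active_items t R. total_size r)) (demand (r # R))"
    by simp
  moreover have "(\<lambda>t. total_size r * indicator (interval r) t +
      (\<Sum>r\<leftarrow>active_items t R. total_size r)) = (\<lambda>t. \<Sum>r\<leftarrow>active_items t (r # R). total_size r)"
    by (auto simp: active_items_def)
  ultimately show ?case by simp
qed

lemma demand_le_opt:
  fixes R :: "'d::finite item list"
  assumes "dvbp_instance R"
  shows "demand R \<le> real CARD('d) * opt R"
proof -
  have vol: "has_bochner_integral lborel (\<lambda>t. \<Sum>r\<leftarrow>active_items t R. total_size r) (demand R)"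
    using duration_pos[OF assms] by (intro has_integral_demand) (auto intro: less_imp_le)
  then have "demand R = (LINT t|lborel. (\<Sum>r\<leftarrow>active_items t R. total_size r))"
    by (simp add: has_bochner_integral_integral_eq)
  also have "\<dots> \<le> (LINT t|lborel. real CARD('d) * real (opt_at R t))"
    using vol integrable_opt_at[OF assms] total_size_active_le_opt_at[OF assms]
    by (intro integral_mono) (auto simp: has_bochner_integral_iff)
  also have "\<dots> = real CARD('d) * opt R"
    by (simp add: opt_def)
  finally show ?thesis .
qed

theorem theorem3:
  fixes R :: "'d::finite item list"
  assumes "dvbp_instance R"
  shows "packing_cost (next_fit R) \<le> (2 * duration_ratio R * real CARD('d) + 1) * opt R"
proof (cases "R = []")
  case True
  \<comment> \<open>The empty instance is separate because \<open>duration_ratio\<close> is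
    meaningless for it; both sides vanish.\<close>
  then have "opt R = 0"
    using opt_at_eq_0_iff[OF assms] by (simp add: opt_def covered_def)
  then show ?thesis
    using True by (simp add: next_fit_def packing_cost_def)
next
  case False
  define m M where "m = Min (duration ` set R)" and "M = Max (duration ` set R)"
  have "0 < m" "0 < M"
    using False duration_pos[OF assms]
    by (auto simp: m_def M_def Max_gr_iff) (meson hd_in_set)
  have "packing_cost (next_fit R) \<le> 2 * (M / m) * demand R + measure lborel (covered R)"
    using \<open>0 < m\<close> \<open>0 < M\<close> by (intro next_fit_cost_le[OF assms]) (auto simp: m_def M_def)
  \<comment> \<open>The charged releases yield the summand with the factor \<open>CARD('d)\<close>,
    the covered time yields the summand 1.\<close>
  also have "\<dots> \<le> 2 * (M / m) * (real CARD('d) * opt R) + opt R"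
    using \<open>0 < m\<close> \<open>0 < M\<close>
    by (intro add_mono mult_left_mono demand_le_opt measure_covered_le_opt assms) auto
  also have "\<dots> = (2 * duration_ratio R * real CARD('d) + 1) * opt R"
    by (simp add: duration_ratio_def m_def M_def algebra_simps)
  finally show ?thesis .
qed

end
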